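(* Let $t\ge 3$ and $1\le n_1\le\cdots\le n_t$ be integers, let $m=\sum_{i=1}^{t-1}n_i$ and $n=n_t$. Then $strc(K_{n_1,\dots,n_t})=1$ if $n=1$; $strc(K_{n_1,\dots,n_t})=3$ if $n\ge 2$ and $m>n$; and $strc(K_{n_1,\dots,n_t})=\lceil\sqrt[m]{n}\,\rceil+1$ if $m\le n$.
   Context: All graphs are finite and simple; $K_{n_1,\dots,n_t}$ is the complete multipartite graph with $t$ classes of sizes $n_1,\dots,n_t$. A total-coloured path (vertices and edges coloured) is total-rainbow if its edges and internal vertices have pairwise distinct colours. $strc(G)$ is the minimum number of colours in a total-colouring of $G$ in which any two vertices $u,v$ are joined by a total-rainbow $u$–$v$ geodesic (a $u$–$v$ path of length $d(u,v)$). *)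

theory Defs
  imports Complex_Main
begin

text \<open>An undirected graph is a pair of a vertex set and a set of edges, an edge being the
  two-element set of its ends.\<close>

type_synonym 'a graph = "'a set \<times> 'a set set"

abbreviation vertices :: "'a graph \<Rightarrow> 'a set" where
  "vertices G \<equiv> fst G"

abbreviation edges :: "'a graph \<Rightarrow> 'a set set" where
  "edges G \<equiv> snd G"

definition finite_simple_graph :: "'a graph \<Rightarrow> bool" where
  "finite_simple_graph G \<longleftrightarrow>
     finite (vertices G) \<and> (\<forall>e\<in>edges G. e \<subseteq> vertices G \<and> card e = 2)"

text \<open>A path is given by the list of its vertices; its length is the number of its edges.\<close>

definition path_edges :: "'a list \<Rightarrow> 'a set list" where
  "path_edges p = map2 (\<lambda>x y. {x, y}) p (tl p)"

definition internal_vertices :: "'a list \<Rightarrow> 'a list" where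
  "internal_vertices p = butlast (tl p)"

definition is_path :: "'a graph \<Rightarrow> 'a \<Rightarrow> 'a list \<Rightarrow> 'a \<Rightarrow> bool" where
  "is_path G u p v \<longleftrightarrow> p \<noteq> [] \<and> hd p = u \<and> last p = v \<and> distinct p \<and>
     set p \<subseteq> vertices G \<and> set (path_edges p) \<subseteq> edges G"

text \<open>The value is unspecified if there is no path between the two vertices.\<close>

definition gdist :: "'a graph \<Rightarrow> 'a \<Rightarrow> 'a \<Rightarrow> nat" where
  "gdist G u v = (LEAST d. \<exists>p. is_path G u p v \<and> length (path_edges p) = d)"

definition geodesic :: "'a graph \<Rightarrow> 'a \<Rightarrow> 'a list \<Rightarrow> 'a \<Rightarrow> bool" where
  "geodesic G u p v \<longleftrightarrow> is_path G u p v \<and> length (path_edges p) = gdist G u v"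

text \<open>A total-colouring colours the disjoint union of the vertices (\<open>Inl\<close>) and the edges
  (\<open>Inr\<close>); it need not be proper. Only its values on \<open>vertices G <+> edges G\<close> matter.\<close>

definition total_rainbow :: "('a + 'a set \<Rightarrow> nat) \<Rightarrow> 'a list \<Rightarrow> bool" where
  "total_rainbow c p \<longleftrightarrow>
     distinct (map c (map Inl (internal_vertices p) @ map Inr (path_edges p)))"

definition strongly_total_rainbow_connected :: "'a graph \<Rightarrow> ('a + 'a set \<Rightarrow> nat) \<Rightarrow> bool" where
  "strongly_total_rainbow_connected G c \<longleftrightarrow>
     (\<forall>u\<in>vertices G. \<forall>v\<in>vertices G. \<exists>p. geodesic G u p v \<and> total_rainbow c p)"

definition strc :: "'a graph \<Rightarrow> nat" where
  "strc G = (LEAST k. \<exists>c. strongly_total_rainbow_connected G c \<and>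
     card (c ` (vertices G <+> edges G)) = k)"

text \<open>The complete multipartite graph with classes indexed by \<open>1, \<dots>, t\<close>, where the class \<open>i\<close>
  is \<open>{i} \<times> {..<ns i}\<close>.\<close>

definition complete_multipartite :: "nat \<Rightarrow> (nat \<Rightarrow> nat) \<Rightarrow> (nat \<times> nat) graph" where
  "complete_multipartite t ns =
     (let V = (SIGMA i:{1..t}. {..<ns i})
      in (V, {{u, v} | u v. u \<in> V \<and> v \<in> V \<and> fst u \<noteq> fst v}))"

lemma finite_simple_graph_complete_multipartite:
  "finite_simple_graph (complete_multipartite t ns)"
  by (auto simp: finite_simple_graph_def complete_multipartite_def Let_def card_2_iff)

end

theory Submission
  imports Defs "HOL-Library.FuncSet"
begin

text \<open>Two distinct vertices \<open>u\<close>, \<open>v\<close> of the same class are at distance 2, and a geodesic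
  \<open>u, w, v\<close> is total-rainbow iff \<open>w\<close>, \<open>uw\<close> and \<open>wv\<close> have distinct colours. Given a good
  colouring with \<open>k\<close> colours, the edges at \<open>w\<close> that share the colour of \<open>w\<close> are useless, so
  each vertex \<open>w\<close> outside the largest class distinguishes the vertices of that class by at most
  \<open>k - 1\<close> values; hence \<open>n \<le> (k - 1) ^ m\<close>. Conversely, give all vertices one colour and
  colour the edges at the largest class with \<open>K\<close> further colours by an \<open>m \<times> n\<close> matrix that
  has distinct columns, and distinct rows within each class. If \<open>m \<le> n\<close>, take as columns any
  \<open>n\<close> words of length \<open>m\<close> that include the \<open>m\<close> unit words. If \<open>n \<le> m\<close>, two colours suffice:
  go around the largest class cyclically, letting each row have a single 1.\<close>

section \<open>Geodesics of length at most two\<close>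

lemma geodesic_refl_iff:
  assumes "u \<in> vertices G"
  shows "geodesic G u p u \<longleftrightarrow> p = [u]"
proof -
  have path: "is_path G u [u] u"
    using assms by (simp add: is_path_def path_edges_def)
  have "gdist G u u = 0"
    unfolding gdist_def using path
    by (intro Least_eq_0 exI[of _ "[u]"]) (simp add: path_edges_def)
  then show ?thesis
    using path by (cases p; cases "tl p") (auto simp: geodesic_def is_path_def path_edges_def)
qed

lemma geodesic_edge:
  assumes "{u, v} \<in> edges G" "u \<noteq> v" "u \<in> vertices G" "v \<in> vertices G"
  shows "geodesic G u [u, v] v"
proof -
  have path: "is_path G u [u, v] v"
    using assms by (simp add: is_path_def path_edges_def)
  have "gdist G u v = 1"
    unfolding gdist_def
  proof (rule Least_equality)
    show "\<exists>p. is_path G u p v \<and> length (path_edges p) = 1"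
      using path by (intro exI[of _ "[u, v]"]) (simp add: path_edges_def)
  next
    fix d assume "\<exists>p. is_path G u p v \<and> length (path_edges p) = d"
    then obtain p where p: "is_path G u p v" "length (path_edges p) = d" by blast
    then show "1 \<le> d"
      using \<open>u \<noteq> v\<close> by (cases p; cases "tl p") (auto simp: is_path_def path_edges_def)
  qed
  then show ?thesis using path by (simp add: geodesic_def path_edges_def)
qed

text \<open>The vertex \<open>w\<close> only certifies that the distance is 2; a geodesic may pass
  through any common neighbour \<open>x\<close>, so the middle vertex is quantified afresh.\<close>

lemma geodesic_common_neighbour_iff:
  assumes "u \<noteq> v" "{u, v} \<notin> edges G"
    and "w \<in> vertices G" "w \<noteq> u" "w \<noteq> v" "{u, w} \<in> edges G" "{w, v} \<in> edges G"
    and "u \<in> vertices G" "v \<in> vertices G"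
  shows "geodesic G u p v \<longleftrightarrow>
    (\<exists>x\<in>vertices G. p = [u, x, v] \<and> x \<noteq> u \<and> x \<noteq> v \<and> {u, x} \<in> edges G \<and> {x, v} \<in> edges G)"
proof -
  have path: "is_path G u [u, w, v] v"
    using assms by (simp add: is_path_def path_edges_def)
  have "gdist G u v = 2"
    unfolding gdist_def
  proof (rule Least_equality)
    show "\<exists>p. is_path G u p v \<and> length (path_edges p) = 2"
      using path by (intro exI[of _ "[u, w, v]"]) (simp add: path_edges_def)
  next
    fix d assume "\<exists>p. is_path G u p v \<and> length (path_edges p) = d"
    then obtain p where p: "is_path G u p v" "length (path_edges p) = d" by blast
    then show "2 \<le> d"
      using assms(1,2)
      by (cases p; cases "tl p"; cases "tl (tl p)") (auto simp: is_path_def path_edges_def)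
  qed
  then show ?thesis
    using assms
    by (cases p; cases "tl p"; cases "tl (tl p)"; cases "tl (tl (tl p))")
      (auto simp: geodesic_def is_path_def path_edges_def)
qed

section \<open>The minimum in \<open>strc\<close> and the prescription of edge colours\<close>

lemma strc_le:
  assumes "strongly_total_rainbow_connected G c"
  shows "strc G \<le> card (c ` (vertices G <+> edges G))"
  unfolding strc_def using assms by (blast intro: Least_le)

lemma strc_attained:
  assumes "strongly_total_rainbow_connected G c0"
  obtains c where "strongly_total_rainbow_connected G c"
    "card (c ` (vertices G <+> edges G)) = strc G"
proof -
  have "\<exists>k c. strongly_total_rainbow_connected G c \<and> card (c ` (vertices G <+> edges G)) = k"
    using assms by blast
  from LeastI_ex[OF this] show thesis
    using that unfolding strc_def by blast
qed

text \<open>The set \<open>{u, v}\<close> determines its ends up to order, so a symmetric function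
  of the ends descends to a function of the edge.\<close>

lemma symmetric_edge_colouring:
  assumes "\<And>u v. s u v = s v u"
  obtains c where "\<And>u v. c {u, v} = s u v"
proof
  fix u v
  show "(THE z. \<exists>x y. {u, v} = {x, y} \<and> z = s x y) = s u v"
    using assms by (intro the_equality) (auto simp: doubleton_eq_iff)
qed

section \<open>Total-rainbow connection in complete multipartite graphs\<close>

lemma vertices_complete_multipartite:
  "vertices (complete_multipartite t ns) = (SIGMA i:{1..t}. {..<ns i})"
  by (simp add: complete_multipartite_def Let_def)

lemma edge_complete_multipartite_iff:
  "{u, v} \<in> edges (complete_multipartite t ns) \<longleftrightarrow>
    u \<in> vertices (complete_multipartite t ns) \<and> v \<in> vertices (complete_multipartite t ns) \<and>
    fst u \<noteq> fst v"
proof -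
  define V where "V = vertices (complete_multipartite t ns)"
  have "edges (complete_multipartite t ns) = {{u, v} | u v. u \<in> V \<and> v \<in> V \<and> fst u \<noteq> fst v}"
    by (simp add: V_def complete_multipartite_def Let_def)
  then show ?thesis
    unfolding V_def[symmetric] mem_Collect_eq by (smt (verit) doubleton_eq_iff mem_Collect_eq)
qed

lemma finite_total_complete_multipartite:
  "finite (vertices (complete_multipartite t ns) <+> edges (complete_multipartite t ns))"
  using finite_simple_graph_complete_multipartite[of t ns]
  unfolding finite_simple_graph_def
  by (auto intro!: finite_Plus
      intro: finite_subset[of _ "Pow (vertices (complete_multipartite t ns))"])

text \<open>Equal or adjacent vertices have a geodesic with no internal vertex and at most one edge,
  which is total-rainbow under any colouring. Only pairs within a class impose a condition, and
  their geodesics have length 2 through another class.\<close>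

lemma strongly_total_rainbow_connected_complete_multipartite_iff:
  assumes "2 \<le> t" and pos: "\<forall>i\<in>{1..t}. 0 < ns i"
  defines "G \<equiv> complete_multipartite t ns"
  shows "strongly_total_rainbow_connected G c \<longleftrightarrow>
    (\<forall>u\<in>vertices G. \<forall>v\<in>vertices G. u \<noteq> v \<longrightarrow> fst u = fst v \<longrightarrow>
      (\<exists>w\<in>vertices G. fst w \<noteq> fst u \<and>
        distinct [c (Inl w), c (Inr {u, w}), c (Inr {w, v})]))"
    (is "_ \<longleftrightarrow> ?R")
proof -
  have V: "vertices G = (SIGMA i:{1..t}. {..<ns i})"
    and E: "\<And>u v. {u, v} \<in> edges G \<longleftrightarrow> u \<in> vertices G \<and> v \<in> vertices G \<and> fst u \<noteq> fst v"
    unfolding G_def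
    by (simp_all add: vertices_complete_multipartite edge_complete_multipartite_iff)
  have geo: "geodesic G u p v \<longleftrightarrow> (\<exists>w\<in>vertices G. p = [u, w, v] \<and> fst w \<noteq> fst u)"
    if uv: "u \<in> vertices G" "v \<in> vertices G" "u \<noteq> v" "fst u = fst v" for u v p
  proof -
    \<comment> \<open>Class 1 or class 2, whichever avoids \<open>u\<close>, supplies a common
      neighbour.\<close>
    define i :: nat where "i = (if fst u = 1 then 2 else 1)"
    have "(i, 0) \<in> vertices G" "i \<noteq> fst u"
      using assms(1) pos by (auto simp: V i_def)
    then show ?thesis
      using uv by (subst geodesic_common_neighbour_iff[of u v G "(i, 0)"]) (auto simp: E)
  qed
  show ?thesis
  proof
    assume L: "strongly_total_rainbow_connected G c"
    show ?R
    proof (intro ballI impI)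
      fix u v assume uv: "u \<in> vertices G" "v \<in> vertices G" "u \<noteq> v" "fst u = fst v"
      then obtain p where p: "geodesic G u p v" "total_rainbow c p"
        using L unfolding strongly_total_rainbow_connected_def by blast
      then obtain w where "w \<in> vertices G" "p = [u, w, v]" "fst w \<noteq> fst u"
        using geo uv by blast
      with p(2) show "\<exists>w\<in>vertices G. fst w \<noteq> fst u \<and>
        distinct [c (Inl w), c (Inr {u, w}), c (Inr {w, v})]"
        by (intro bexI[of _ w]) (auto simp: total_rainbow_def internal_vertices_def path_edges_def)
    qed
  next
    assume R: ?R
    show "strongly_total_rainbow_connected G c"
      unfolding strongly_total_rainbow_connected_def
    proof (intro ballI)
      fix u v assume uv: "u \<in> vertices G" "v \<in> vertices G"
      consider "u = v" | "fst u \<noteq> fst v" | "u \<noteq> v" "fst u = fst v" by blast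
      then show "\<exists>p. geodesic G u p v \<and> total_rainbow c p"
      proof cases
        case 1
        then show ?thesis
          using uv by (intro exI[of _ "[u]"])
            (simp add: geodesic_refl_iff total_rainbow_def internal_vertices_def path_edges_def)
      next
        case 2
        then have "geodesic G u [u, v] v"
          using uv by (intro geodesic_edge) (auto simp: E)
        then show ?thesis
          by (intro exI[of _ "[u, v]"])
            (simp add: total_rainbow_def internal_vertices_def path_edges_def)
      next
        case 3
        then obtain w where w: "w \<in> vertices G" "fst w \<noteq> fst u"
          "distinct [c (Inl w), c (Inr {u, w}), c (Inr {w, v})]"
          using R uv by blast
        then have "geodesic G u [u, w, v] v" using geo 3 uv by blast
        with w(3) show ?thesis
          by (intro exI[of _ "[u, w, v]"])
            (simp add: total_rainbow_def internal_vertices_def path_edges_def)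
      qed
    qed
  qed
qed

section \<open>Upper bound from a matrix of edge colours\<close>

text \<open>The entry \<open>a x k\<close> colours the edge from \<open>x\<close> to
  \<open>(t, k)\<close>. Pairs in the last class are separated by \<open>cols\<close>, pairs in
  another class by \<open>rows\<close>. The colouring itself is returned too, since the
  \<open>LEAST\<close> in \<open>strc\<close> is attained once some colouring exists.\<close>

lemma strc_complete_multipartite_le:
  fixes a :: "nat \<times> nat \<Rightarrow> nat \<Rightarrow> nat"
  assumes "2 \<le> t" and pos: "\<forall>i\<in>{1..t}. 0 < ns i"
  defines "X \<equiv> SIGMA i:{1..<t}. {..<ns i}"
  assumes "0 < K" and bound: "\<And>x k. x \<in> X \<Longrightarrow> k < ns t \<Longrightarrow> a x k < K"
    and rows: "\<And>x y. x \<in> X \<Longrightarrow> y \<in> X \<Longrightarrow> x \<noteq> y \<Longrightarrow> fst x = fst y \<Longrightarrow> \<exists>k<ns t. a x k \<noteq> a y k"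
    and cols: "\<And>k l. k < ns t \<Longrightarrow> l < ns t \<Longrightarrow> k \<noteq> l \<Longrightarrow> \<exists>x\<in>X. a x k \<noteq> a x l"
  obtains c where "strongly_total_rainbow_connected (complete_multipartite t ns) c"
    "strc (complete_multipartite t ns) \<le> K + 1"
proof -
  define G where "G = complete_multipartite t ns"
  have V: "vertices G = (SIGMA i:{1..t}. {..<ns i})"
    and E: "edges G = {{u, v} | u v. u \<in> vertices G \<and> v \<in> vertices G \<and> fst u \<noteq> fst v}"
    unfolding G_def complete_multipartite_def Let_def by auto
  \<comment> \<open>Edges between two of the first \<open>t - 1\<close> classes get colour 0, which
    lies below \<open>K\<close> and so adds no colour.\<close>
  define s where "s u v = (if fst u \<noteq> t \<and> fst v = t then a u (snd v)
    else if fst u = t \<and> fst v \<noteq> t then a v (snd u) else 0)" for u v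
  have "s u v = s v u" for u v by (simp add: s_def)
  then obtain ce where ce: "\<And>u v. ce {u, v} = s u v"
    using symmetric_edge_colouring by metis
  define c :: "nat \<times> nat + (nat \<times> nat) set \<Rightarrow> nat" where "c = case_sum (\<lambda>_. K) ce"
  have cl: "c (Inl v) = K" for v by (simp add: c_def)
  have cr: "c (Inr {u, v}) = s u v" for u v by (simp add: c_def ce)
  have s_less: "s u v < K" if "u \<in> vertices G" "v \<in> vertices G" for u v
    using that \<open>0 < K\<close> by (auto simp: s_def V X_def intro!: bound)
  have conn: "strongly_total_rainbow_connected G c"
  proof (rule strongly_total_rainbow_connected_complete_multipartite_iff
        [OF \<open>2 \<le> t\<close> pos, THEN iffD2, folded G_def], intro ballI impI)
    fix u v assume uv: "u \<in> vertices G" "v \<in> vertices G" "u \<noteq> v" "fst u = fst v"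
    \<comment> \<open>Vertices have colour \<open>K\<close> and edges smaller colours, so it
      suffices that the two edges at \<open>w\<close> differ.\<close>
    have "\<exists>w\<in>vertices G. fst w \<noteq> fst u \<and> s u w \<noteq> s w v"
    proof (cases "fst u = t")
      case True
      then have "snd u < ns t" "snd v < ns t" "snd u \<noteq> snd v"
        using uv by (auto simp: V prod_eq_iff)
      then obtain x where "x \<in> X" "a x (snd u) \<noteq> a x (snd v)" using cols by blast
      then show ?thesis
        using True uv by (intro bexI[of _ x]) (auto simp: s_def X_def V)
    next
      case False
      then have "u \<in> X" "v \<in> X" using uv by (auto simp: V X_def)
      then obtain k where "k < ns t" "a u k \<noteq> a v k" using rows uv by blast
      then show ?thesis
        using False uv \<open>2 \<le> t\<close> by (intro bexI[of _ "(t, k)"]) (auto simp: s_def V)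
    qed
    then obtain w where w: "w \<in> vertices G" "fst w \<noteq> fst u" "s u w \<noteq> s w v" by blast
    have "s u w < K" "s w v < K" using s_less uv w by blast+
    with w show "\<exists>w\<in>vertices G. fst w \<noteq> fst u \<and>
        distinct [c (Inl w), c (Inr {u, w}), c (Inr {w, v})]"
      by (intro bexI[of _ w]) (auto simp: cl cr)
  qed
  have "c x \<le> K" if "x \<in> vertices G <+> edges G" for x
    using that s_less by (auto simp: cl cr E less_imp_le)
  then have "c ` (vertices G <+> edges G) \<subseteq> {..K}" by blast
  from card_mono[OF _ this] strc_le[OF conn] have "strc G \<le> K + 1" by simp
  with conn show thesis using that by (simp add: G_def)
qed

section \<open>Lower bound by counting\<close>

text \<open>A total-rainbow geodesic between two vertices of the last class already shows three
  colours. For the second bound, each vertex of that class is encoded by the colours of its edges to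
  \<open>X\<close>, with one colour per coordinate made redundant.\<close>

lemma card_colours_lower_bound:
  assumes "2 \<le> t" and pos: "\<forall>i\<in>{1..t}. 0 < ns i" and "2 \<le> ns t"
  defines "G \<equiv> complete_multipartite t ns"
  assumes conn: "strongly_total_rainbow_connected G c"
  defines "k \<equiv> card (c ` (vertices G <+> edges G))"
  shows "3 \<le> k" "ns t \<le> (k - 1) ^ (\<Sum>i=1..<t. ns i)"
proof -
  define C where "C = c ` (vertices G <+> edges G)"
  define X where "X = (SIGMA i:{1..<t}. {..<ns i})"
  have V: "vertices G = (SIGMA i:{1..t}. {..<ns i})"
    and E: "\<And>u v. {u, v} \<in> edges G \<longleftrightarrow> u \<in> vertices G \<and> v \<in> vertices G \<and> fst u \<noteq> fst v"
    unfolding G_def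
    by (simp_all add: vertices_complete_multipartite edge_complete_multipartite_iff)
  have fin: "finite C"
    unfolding C_def G_def by (intro finite_imageI finite_total_complete_multipartite)
  have finX: "finite X" by (simp add: X_def)
  have cardX: "card X = (\<Sum>i=1..<t. ns i)" by (simp add: X_def)
  have vC: "c (Inl v) \<in> C" if "v \<in> vertices G" for v
    using that by (auto simp: C_def)
  have eC: "c (Inr {u, v}) \<in> C" if "u \<in> vertices G" "v \<in> vertices G" "fst u \<noteq> fst v" for u v
    using that unfolding C_def by (intro imageI InrI) (simp add: E)
  have sep': "\<forall>u\<in>vertices G. \<forall>v\<in>vertices G. u \<noteq> v \<longrightarrow> fst u = fst v \<longrightarrow>
      (\<exists>w\<in>vertices G. fst w \<noteq> fst u \<and>
        distinct [c (Inl w), c (Inr {u, w}), c (Inr {w, v})])"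
    using strongly_total_rainbow_connected_complete_multipartite_iff[OF \<open>2 \<le> t\<close> pos] conn
    unfolding G_def by blast
  have sep: "\<exists>w\<in>X. distinct [c (Inl w), c (Inr {(t, p), w}), c (Inr {w, (t, q)})]"
    if "p < ns t" "q < ns t" "p \<noteq> q" for p q
  proof -
    have "(t, p) \<in> vertices G" "(t, q) \<in> vertices G" "(t, p) \<noteq> (t, q)"
      using that \<open>2 \<le> t\<close> by (auto simp: V)
    then obtain w where "w \<in> vertices G" "fst w \<noteq> t"
        "distinct [c (Inl w), c (Inr {(t, p), w}), c (Inr {w, (t, q)})]"
      using sep'[rule_format, of "(t, p)" "(t, q)"] by auto
    moreover from this have "w \<in> X" by (auto simp: V X_def)
    ultimately show ?thesis by blast
  qed
  have XV: "w \<in> vertices G" "fst w \<noteq> t" if "w \<in> X" for w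
    using that by (auto simp: X_def V)
  have tV: "(t, p) \<in> vertices G" if "p < ns t" for p
    using that \<open>2 \<le> t\<close> by (auto simp: V)
  show "3 \<le> k"
  proof -
    obtain w where w: "w \<in> X" "distinct [c (Inl w), c (Inr {(t, 0), w}), c (Inr {w, (t, 1)})]"
      using sep[of 0 1] \<open>2 \<le> ns t\<close> by auto
    have "set [c (Inl w), c (Inr {(t, 0), w}), c (Inr {w, (t, 1)})] \<subseteq> C"
      using w(1) XV[OF w(1)] tV[of 0] tV[of 1] \<open>2 \<le> ns t\<close> by (auto intro!: vC eC)
    from card_mono[OF fin this] show ?thesis
      unfolding distinct_card[OF w(2)] by (simp add: k_def C_def)
  qed
  have card_diff: "card (C - {c (Inl w)}) = k - 1" if "w \<in> X" for w
    using that XV vC fin by (simp add: k_def C_def[symmetric])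
  \<comment> \<open>The default \<open>d w\<close> replaces the colour of \<open>w\<close> on edges
    at \<open>w\<close>, leaving \<open>k - 1\<close> values per coordinate. It exists because
    \<open>k - 1\<close> is positive.\<close>
  define d where "d w = (SOME z. z \<in> C - {c (Inl w)})" for w
  have d: "d w \<in> C - {c (Inl w)}" if "w \<in> X" for w
  proof -
    have "C - {c (Inl w)} \<noteq> {}"
      using card_diff[OF that] \<open>3 \<le> k\<close> by (intro notI) simp
    then show ?thesis unfolding d_def some_in_eq .
  qed
  define r where "r p = (\<lambda>w\<in>X. if c (Inr {(t, p), w}) = c (Inl w) then d w
    else c (Inr {(t, p), w}))" for p
  have "inj_on r {..<ns t}"
  proof (rule inj_onI, rule ccontr)
    fix p q assume pq: "p \<in> {..<ns t}" "q \<in> {..<ns t}" "r p = r q" "p \<noteq> q"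
    \<comment> \<open>At a vertex \<open>w\<close> separating \<open>p\<close> and \<open>q\<close>,
      neither edge has the colour of \<open>w\<close>, so nothing is replaced and
      \<open>r p\<close>, \<open>r q\<close> differ at \<open>w\<close>.\<close>
    then obtain w where w: "w \<in> X"
        "distinct [c (Inl w), c (Inr {(t, p), w}), c (Inr {w, (t, q)})]"
      using sep by blast
    have "r p w = r q w" using pq(3) by simp
    with w show False by (auto simp: r_def insert_commute)
  qed
  moreover have "r ` {..<ns t} \<subseteq> PiE X (\<lambda>w. C - {c (Inl w)})"
    using d by (auto simp: r_def X_def V \<open>2 \<le> t\<close> Suc_leD intro!: eC split: if_splits)
  moreover have "finite (PiE X (\<lambda>w. C - {c (Inl w)}))"
    using fin finX by (intro finite_PiE) auto
  ultimately have "card {..<ns t} \<le> card (PiE X (\<lambda>w. C - {c (Inl w)}))"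
    by (rule card_inj_on_le)
  also have "\<dots> = (k - 1) ^ card X"
    using card_diff by (simp add: card_PiE[OF finX])
  finally show "ns t \<le> (k - 1) ^ (\<Sum>i=1..<t. ns i)" by (simp add: cardX)
qed

section \<open>Matrices with distinct rows and columns\<close>

text \<open>The unit words are \<open>card X\<close> distinct members of the
  \<open>K ^ card X\<close> words, so some set of exactly \<open>n\<close> words contains them.
  Injectivity of \<open>h\<close> makes the columns distinct, and the unit word at \<open>x\<close>
  separates row \<open>x\<close> from all others.\<close>

lemma words_with_units:
  fixes X :: "'a set"
  assumes "finite X" "card X \<le> n" "2 \<le> K" "n \<le> K ^ card X"
  obtains h :: "nat \<Rightarrow> 'a \<Rightarrow> nat" where "inj_on h {..<n}" "h ` {..<n} \<subseteq> PiE X (\<lambda>_. {..<K})"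
    "\<And>x. x \<in> X \<Longrightarrow> \<exists>k<n. h k = (\<lambda>y\<in>X. of_bool (y = x))"
proof -
  define e :: "'a \<Rightarrow> 'a \<Rightarrow> nat" where "e x = (\<lambda>y\<in>X. of_bool (y = x))" for x
  have "inj_on e X"
  proof (rule inj_onI)
    fix x y assume xy: "x \<in> X" "y \<in> X" "e x = e y"
    then have "e x x = e y x" by simp
    with xy(1) have "(1 :: nat) = of_bool (x = y)" by (simp add: e_def)
    then show "x = y" by (simp split: if_splits add: of_bool_def)
  qed
  then have "card (e ` X) \<le> n" using assms by (simp add: card_image)
  moreover have "e ` X \<subseteq> PiE X (\<lambda>_. {..<K})" using assms by (auto simp: e_def)
  moreover have "n \<le> card (PiE X (\<lambda>_. {..<K}))" using assms by (simp add: card_PiE)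
  moreover have "finite (PiE X (\<lambda>_. {..<K}))" using assms by (intro finite_PiE) auto
  ultimately obtain T where T: "e ` X \<subseteq> T" "T \<subseteq> PiE X (\<lambda>_. {..<K})" "card T = n"
    using exists_subset_between by metis
  then have "finite T"
    using \<open>finite (PiE X (\<lambda>_. {..<K}))\<close> finite_subset by blast
  then obtain h where h: "bij_betw h {..<n} T"
    using ex_bij_betw_nat_finite[of T] T(3) by (auto simp: atLeast0LessThan)
  show thesis
  proof (rule that)
    show "inj_on h {..<n}" "h ` {..<n} \<subseteq> PiE X (\<lambda>_. {..<K})"
      using h T by (auto simp: bij_betw_def)
    fix x assume "x \<in> X"
    then have "e x \<in> h ` {..<n}" using h T by (auto simp: bij_betw_def)
    then show "\<exists>k<n. h k = (\<lambda>y\<in>X. of_bool (y = x))" by (auto simp: e_def)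
  qed
qed

text \<open>Blocks of lengths \<open>ns 1\<close>, \<open>ns 2\<close> and so on, laid end to end
  from 0, leave no gaps; the induction appends one block.\<close>

lemma prefix_sum_cover:
  fixes ns :: "nat \<Rightarrow> nat"
  assumes "k < (\<Sum>i=1..<t. ns i)"
  shows "\<exists>i\<in>{1..<t}. \<exists>j<ns i. (\<Sum>l=1..<i. ns l) + j = k"
  using assms
proof (induction t)
  case (Suc t)
  show ?case
  proof (cases "k < (\<Sum>i=1..<t. ns i)")
    case True
    then show ?thesis using Suc.IH by fastforce
  next
    case False
    \<comment> \<open>Here \<open>k\<close> falls into the appended block \<open>t\<close>; for
      \<open>t = 0\<close> the range of summation would be empty, leaving no room for
      \<open>k\<close>.\<close>
    then have "1 \<le> t" using Suc.prems by (cases t) auto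
    then show ?thesis
      using False Suc.prems
      by (intro bexI[of _ t] exI[of _ "k - (\<Sum>i=1..<t. ns i)"]) auto
  qed
qed simp

text \<open>The classes are laid consecutively around a cycle of length \<open>n\<close>. Their
  total is at least \<open>n\<close>, so every position is met, and a class of size at most
  \<open>n\<close> does not overlap itself. The value \<open>f x\<close> will be the column holding
  the single 1 of row \<open>x\<close>.\<close>

lemma cyclic_cover:
  fixes ns :: "nat \<Rightarrow> nat"
  assumes "\<And>i. i \<in> {1..<t} \<Longrightarrow> ns i \<le> n" "n \<le> (\<Sum>i=1..<t. ns i)"
  defines "X \<equiv> SIGMA i:{1..<t}. {..<ns i}"
  obtains f :: "nat \<times> nat \<Rightarrow> nat" where "\<And>k. k < n \<Longrightarrow> \<exists>x\<in>X. f x = k" "\<And>x. x \<in> X \<Longrightarrow> f x < n"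
    "\<And>x y. x \<in> X \<Longrightarrow> y \<in> X \<Longrightarrow> fst x = fst y \<Longrightarrow> f x = f y \<Longrightarrow> x = y"
proof
  let ?f = "\<lambda>x. ((\<Sum>l=1..<fst x. ns l) + snd x) mod n"
  fix k assume "k < n"
  then obtain i j where "i \<in> {1..<t}" "j < ns i" "(\<Sum>l=1..<i. ns l) + j = k"
    using prefix_sum_cover[of k ns t] assms(2) by auto
  with \<open>k < n\<close> show "\<exists>x\<in>X. ?f x = k"
    by (intro bexI[of _ "(i, j)"]) (auto simp: X_def)
next
  let ?f = "\<lambda>x. ((\<Sum>l=1..<fst x. ns l) + snd x) mod n"
  fix x assume "x \<in> X"
  then have "0 < n" using assms(1)[of "fst x"] by (auto simp: X_def)
  then show "?f x < n" by simp
next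
  let ?f = "\<lambda>x. ((\<Sum>l=1..<fst x. ns l) + snd x) mod n"
  fix x y assume xy: "x \<in> X" "y \<in> X" "fst x = fst y" "?f x = ?f y"
  have "snd x < n" "snd y < n"
    using xy assms(1)[of "fst x"] by (auto simp: X_def)
  \<comment> \<open>The prefix sum depends only on the class, so it cancels modulo
    \<open>n\<close>.\<close>
  moreover have "snd x mod n = snd y mod n"
    using xy(3,4) by (auto simp: nat_mod_eq_iff)
  ultimately show "x = y" using xy(3) by (simp add: prod_eq_iff)
qed

section \<open>The rounded-up root\<close>

text \<open>Together with \<open>ceiling_root_le\<close>, this makes the rounded-up root the least
  \<open>k\<close> with \<open>n \<le> k ^ m\<close>, linking the formula to the counting
  bounds.\<close>

lemma le_nat_ceiling_root_power:
  assumes "0 < m"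
  shows "n \<le> nat \<lceil>root m (real n)\<rceil> ^ m"
proof -
  have "real n = root m (real n) ^ m" using assms by simp
  also have "\<dots> \<le> real (nat \<lceil>root m (real n)\<rceil>) ^ m"
    by (intro power_mono real_nat_ceiling_ge real_root_ge_zero) auto
  finally show ?thesis by (metis of_nat_le_iff of_nat_power)
qed

lemma ceiling_root_le:
  assumes "0 < m" "n \<le> k ^ m"
  shows "\<lceil>root m (real n)\<rceil> \<le> int k"
proof -
  have "root m (real n) \<le> root m (real k ^ m)"
    using assms by (metis of_nat_le_iff of_nat_power real_root_le_mono)
  then show ?thesis using assms by (simp add: real_root_power_cancel ceiling_le_iff)
qed

section \<open>The three cases of the formula\<close>

theorem theorem3p9:
  fixes t m n :: nat and ns :: "nat \<Rightarrow> nat"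
  assumes "3 \<le> t"
    and "1 \<le> ns 1"
    and "mono_on {1..t} ns"
    and "m = (\<Sum>i=1..t-1. ns i)"
    and "n = ns t"
  shows "(n = 1 \<longrightarrow> strc (complete_multipartite t ns) = 1) \<and>
    (2 \<le> n \<and> n < m \<longrightarrow> strc (complete_multipartite t ns) = 3) \<and>
    (m \<le> n \<longrightarrow> int (strc (complete_multipartite t ns)) = \<lceil>root m (real n)\<rceil> + 1)"
proof -
  define G where "G = complete_multipartite t ns"
  define X where "X = (SIGMA i:{1..<t}. {..<ns i})"
  have pos: "\<forall>i\<in>{1..t}. 0 < ns i"
    using mono_onD[OF assms(3), of 1] assms(2) by fastforce
  have le_n: "ns i \<le> n" if "i \<in> {1..t}" for i
    using mono_onD[OF assms(3), of i t] that assms(1,5) by auto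
  have "{1..t-1} = {1..<t}" using assms(1) by auto
  then have m: "m = (\<Sum>i=1..<t. ns i)" using assms(4) by simp
  have cardX: "card X = m" by (simp add: X_def m)
  have "(\<Sum>i=1..<t. 1) \<le> m"
    unfolding m using pos by (intro sum_mono) (auto simp: Suc_le_eq)
  then have "2 \<le> m" using assms(1) by simp
  have "2 \<le> t" using assms(1) by simp
  note upper = strc_complete_multipartite_le[OF \<open>2 \<le> t\<close> pos, folded X_def assms(5) G_def]
  note lower = card_colours_lower_bound[OF \<open>2 \<le> t\<close> pos, folded m assms(5) G_def]
  have V: "vertices G = (SIGMA i:{1..t}. {..<ns i})"
    unfolding G_def by (rule vertices_complete_multipartite)
  have one: "strc G = 1" if "n = 1"
  proof -
    \<comment> \<open>All classes are singletons, so no pair needs separating and every colouring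
      works, even a constant one.\<close>
    have "u = v" if "u \<in> vertices G" "v \<in> vertices G" "fst u = fst v" for u v
      using that le_n[of "fst u"] \<open>n = 1\<close> by (auto simp: V prod_eq_iff)
    then have conn: "strongly_total_rainbow_connected G c"
      for c :: "nat \<times> nat + (nat \<times> nat) set \<Rightarrow> nat"
      using strongly_total_rainbow_connected_complete_multipartite_iff[OF \<open>2 \<le> t\<close> pos]
      unfolding G_def by blast
    have "(1, 0) \<in> vertices G" using pos assms(1) by (simp add: V)
    then have ne: "vertices G <+> edges G \<noteq> {}" by blast
    have fin: "finite (vertices G <+> edges G)"
      unfolding G_def by (rule finite_total_complete_multipartite)
    have "strc G \<le> 1"
      using strc_le[OF conn[of "\<lambda>_. 0"]] by (simp only: image_constant_conv ne) simp
    moreover obtain c where "strongly_total_rainbow_connected G c"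
        "card (c ` (vertices G <+> edges G)) = strc G"
      using strc_attained[OF conn] .
    then have "strc G \<noteq> 0" using fin ne by (metis card_0_eq finite_imageI image_is_empty)
    ultimately show ?thesis by simp
  qed
  have two: "strc G = 3" if "2 \<le> n" "n < m"
  proof -
    obtain f where f: "\<And>k. k < n \<Longrightarrow> \<exists>x\<in>X. f x = k" "\<And>x. x \<in> X \<Longrightarrow> f x < n"
        "\<And>x y. x \<in> X \<Longrightarrow> y \<in> X \<Longrightarrow> fst x = fst y \<Longrightarrow> f x = f y \<Longrightarrow> x = y"
    proof (rule cyclic_cover[of t ns n, folded X_def])
      show "ns i \<le> n" if "i \<in> {1..<t}" for i using le_n that by simp
      show "n \<le> (\<Sum>i=1..<t. ns i)" using \<open>n < m\<close> by (simp add: m)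
    qed blast
    \<comment> \<open>Row \<open>x\<close> has its single 1 in column \<open>f x\<close>. Rows of
      one class differ since \<open>f\<close> is injective there; columns \<open>k\<close> and
      \<open>l\<close> differ at any \<open>x\<close> with \<open>f x = k\<close>.\<close>
    obtain c0 where c0: "strongly_total_rainbow_connected G c0" "strc G \<le> 2 + 1"
    proof (rule upper[where K = 2 and a = "\<lambda>x k. of_bool (f x = k)"])
      fix x y assume "x \<in> X" "y \<in> X" "x \<noteq> y" "fst x = fst y"
      then have "f x \<noteq> f y" "f x < n" using f by blast+
      then show "\<exists>k<n. of_bool (f x = k) \<noteq> (of_bool (f y = k) :: nat)"
        by (intro exI[of _ "f x"]) auto
    next
      fix k l assume "k < n" "k \<noteq> l"
      then show "\<exists>x\<in>X. of_bool (f x = k) \<noteq> (of_bool (f x = l) :: nat)"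
        using f(1)[of k] by auto
    qed auto
    obtain c where "strongly_total_rainbow_connected G c"
        "card (c ` (vertices G <+> edges G)) = strc G"
      using strc_attained[OF c0(1)] .
    with lower(1)[of c] \<open>2 \<le> n\<close> c0(2) show ?thesis by simp
  qed
  have three: "int (strc G) = \<lceil>root m (real n)\<rceil> + 1" if "m \<le> n"
  proof -
    define K where "K = nat \<lceil>root m (real n)\<rceil>"
    have "2 \<le> n" using \<open>2 \<le> m\<close> that by simp
    have "n \<le> K ^ m"
      unfolding K_def using \<open>2 \<le> m\<close> by (intro le_nat_ceiling_root_power) simp
    \<comment> \<open>The entries 0 and 1 of the unit words must be available as edge
      colours.\<close>
    have "2 \<le> K"
    proof (rule ccontr)
      assume "\<not> 2 \<le> K"
      then have "K ^ m \<le> 1 ^ m" by (intro power_mono) auto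
      then show False using \<open>n \<le> K ^ m\<close> \<open>2 \<le> n\<close> by simp
    qed
    have "finite X" by (simp add: X_def)
    then obtain h :: "nat \<Rightarrow> nat \<times> nat \<Rightarrow> nat"
      where h: "inj_on h {..<n}" "h ` {..<n} \<subseteq> PiE X (\<lambda>_. {..<K})"
        "\<And>x. x \<in> X \<Longrightarrow> \<exists>k<n. h k = (\<lambda>y\<in>X. of_bool (y = x))"
    proof (rule words_with_units)
      show "card X \<le> n" "n \<le> K ^ card X" using \<open>m \<le> n\<close> \<open>n \<le> K ^ m\<close> by (simp_all add: cardX)
    qed (use \<open>2 \<le> K\<close> in auto)
    obtain c0 where c0: "strongly_total_rainbow_connected G c0" "strc G \<le> K + 1"
    proof (rule upper[where K = K and a = "\<lambda>x k. h k x"])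
      show "0 < K" using \<open>2 \<le> K\<close> by simp
    next
      fix x k assume "x \<in> X" "k < n"
      then show "h k x < K" using h(2) by (auto simp: image_subset_iff PiE_iff)
    next
      fix x y assume xy: "x \<in> X" "y \<in> X" "x \<noteq> y"
      \<comment> \<open>In the column that is the unit word at \<open>x\<close>, row
        \<open>x\<close> has 1 and row \<open>y\<close> has 0, whatever their classes.\<close>
      then obtain k where "k < n" "h k = (\<lambda>z\<in>X. of_bool (z = x))" using h(3) by blast
      with xy show "\<exists>k<n. h k x \<noteq> h k y" by (intro exI[of _ k]) simp
    next
      fix k l assume kl: "k < n" "l < n" "k \<noteq> l"
      then have "h k \<noteq> h l" using h(1) by (auto simp: inj_on_def)
      moreover have "h k \<in> PiE X (\<lambda>_. {..<K})" "h l \<in> PiE X (\<lambda>_. {..<K})"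
        using kl h(2) by auto
      \<comment> \<open>Both functions are extensional on \<open>X\<close>, so being distinct they
        differ at a point of \<open>X\<close>.\<close>
      ultimately show "\<exists>x\<in>X. h k x \<noteq> h l x" by (meson PiE_ext)
    qed auto
    obtain c where "strongly_total_rainbow_connected G c"
        "card (c ` (vertices G <+> edges G)) = strc G"
      using strc_attained[OF c0(1)] .
    with lower[of c] \<open>2 \<le> n\<close> have low: "3 \<le> strc G" "n \<le> (strc G - 1) ^ m" by simp_all
    \<comment> \<open>The counting bound is applied to an optimal colouring; the natural subtraction
      loses nothing as \<open>3 \<le> strc G\<close>.\<close>
    have "\<lceil>root m (real n)\<rceil> \<le> int (strc G - 1)"
      using low \<open>2 \<le> m\<close> by (intro ceiling_root_le) auto
    moreover have "int K = \<lceil>root m (real n)\<rceil>"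
      using \<open>2 \<le> K\<close> unfolding K_def by linarith
    ultimately show ?thesis using low(1) c0(2) by linarith
  qed
  show ?thesis using one two three by (simp add: G_def)
qed

end
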